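(* Let $q>1$, let $\Sigma\sim\mathrm{Mallows}(\mathbb{Z},1/q)$, and define $c_e:=\mathbb{E}\,C_1(\rho\circ\Sigma)$ and $c_o:=\mathbb{E}\,C_1(r\circ\Sigma)$. Then: (1) $c_e=\mathbb{P}(\Sigma(0)\text{ is odd})$ and $c_o=\mathbb{P}(\Sigma(0)\text{ is even})$ (in particular $c_e+c_o=1$). (2) $\lim_{q\downarrow1}c_e=\lim_{q\downarrow1}c_o=\tfrac12$, $\lim_{q\to\infty}c_e=0$, $\lim_{q\to\infty}c_o=1$; moreover $c_o=1-2/q+o(1/q)$ and $c_e=2/q+o(1/q)$ as $q\to\infty$.
   Context: For a finite set $A\subseteq\mathbb{Z}$ and a bijection $\pi:A\to A$, $\mathrm{inv}(\pi)$ is the number of pairs $i<j$ in $A$ with $\pi(i)>\pi(j)$, and $\Pi_A\sim\mathrm{Mallows}(A,q)$ means $\mathbb{P}(\Pi_A=\pi)\propto q^{\mathrm{inv}(\pi)}$ over bijections $\pi$ of $A$. For a bijection $\sigma$ of a set $B\subseteq\mathbb{Z}$ and finite $A\subseteq B$, the pattern $\sigma_A:A\to A$ is defined by $\sigma_A(a)=a_{(i)}$ when $\sigma(a)$ is the $i$-th smallest element of $\sigma[A]$, where $a_{(i)}$ is the $i$-th smallest element of $A$. For $0<q<1$, $\mathrm{Mallows}(\mathbb{Z},q)$ is Gnedin and Olshanski's bi-infinite Mallows measure: the law of a random bijection $\Sigma$ of $\mathbb{Z}$ such that $\Sigma_I\sim\mathrm{Mallows}(I,q)$ for every finite interval of integers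 $I$, and, with $I_n=\{-n,\dots,n\}$, almost surely for every $i\in\mathbb{Z}$ one has $\Sigma_{I_n}(i)=\Sigma(i)$ for all sufficiently large $n$. $C_1(\pi)$ is the number of fixed points of a permutation $\pi$ of $\mathbb{Z}$. The maps $r,\rho:\mathbb{Z}\to\mathbb{Z}$ are $r(i)=-i$, $\rho(i)=1-i$. *)

theory Defs
  imports "HOL-Probability.Probability" "HOL-Combinatorics.Permutations" "HOL-Library.Landau_Symbols"
begin

text \<open>Bijections of a finite set A \<subseteq> int are represented as functions int \<Rightarrow> int that
  permute A (identity outside A).\<close>

definition inv_count :: "int set \<Rightarrow> (int \<Rightarrow> int) \<Rightarrow> nat" where
  "inv_count A \<pi> = card {(i, j). i \<in> A \<and> j \<in> A \<and> i < j \<and> \<pi> i > \<pi> j}"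

definition mallows_prob :: "real \<Rightarrow> int set \<Rightarrow> (int \<Rightarrow> int) \<Rightarrow> real" where
  "mallows_prob q A \<pi> = q ^ inv_count A \<pi> / (\<Sum>\<tau>\<in>{\<tau>. \<tau> permutes A}. q ^ inv_count A \<tau>)"

definition pattern :: "(int \<Rightarrow> int) \<Rightarrow> int set \<Rightarrow> int \<Rightarrow> int" where
  "pattern \<sigma> A a = (if a \<in> A then sorted_list_of_set A ! card {b \<in> A. \<sigma> b < \<sigma> a} else a)"

text \<open>Characterisation of a random bijection Sg of the integers on the probability space M
  having law Mallows(\<int>, q) (Gnedin--Olshanski bi-infinite Mallows measure).\<close>
definition bi_mallows :: "real \<Rightarrow> 'w measure \<Rightarrow> ('w \<Rightarrow> int \<Rightarrow> int) \<Rightarrow> bool" where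
  "bi_mallows q M Sg \<longleftrightarrow>
     prob_space M \<and>
     (\<forall>\<omega>\<in>space M. bij (Sg \<omega>)) \<and>
     (\<forall>i. (\<lambda>\<omega>. Sg \<omega> i) \<in> measurable M (count_space UNIV)) \<and>
     (\<forall>a b :: int. \<forall>\<pi>. \<pi> permutes {a..b} \<longrightarrow>
        measure M {\<omega> \<in> space M. pattern (Sg \<omega>) {a..b} = \<pi>} = mallows_prob q {a..b} \<pi>) \<and>
     (AE \<omega> in M. \<forall>i. \<exists>N. \<forall>n\<ge>N. pattern (Sg \<omega>) {- int n..int n} i = Sg \<omega> i)"

definition C1 :: "(int \<Rightarrow> int) \<Rightarrow> ennreal" where
  "C1 \<pi> = emeasure (count_space UNIV) {i. \<pi> i = i}"

definition r_map :: "int \<Rightarrow> int" where "r_map i = - i"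
definition rho_map :: "int \<Rightarrow> int" where "rho_map i = 1 - i"

end

theory Submission
  imports Defs
begin

text \<open>Write \<open>p i j\<close> for the probability that \<open>\<Sigma> i = j\<close>; it is the limit of the corresponding
  probabilities for the finite Mallows measures on \<open>{-n..n}\<close>.  Building a Mallows permutation of
  \<open>{a..b+1}\<close> from one of \<open>{a..b}\<close> by inserting the value of \<open>b + 1\<close> changes these probabilities
  only by an exponentially small amount, so \<open>{-n..n+1}\<close> gives the same limit.  Both intervals are
  symmetric, which makes \<open>p\<close> invariant under \<open>x \<mapsto> -x\<close> and \<open>x \<mapsto> 1 - x\<close>, hence under
  translations, and (1) follows by summing over \<open>i\<close>.  For (2), exchanging the values
  \<open>j\<close> and \<open>j + 1\<close> changes the number of inversions by at most one, so
  \<open>p i j\<close> and \<open>p i (j + 1)\<close> agree up to a factor \<open>1/q\<close>; and the insertion procedure gives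
  \<open>p 0 0 \<ge> 1 - 2/q\<close>.  The probability that \<open>\<Sigma> 0\<close> is odd is at most \<open>1 - p 0 0\<close>
  and at least \<open>p 0 1 + p 0 (-1) \<ge> (2/q) p 0 0\<close>.\<close>

section \<open>Finite Mallows measures: partition function and one-point probabilities\<close>

definition mallows_sum :: "real \<Rightarrow> int set \<Rightarrow> real" where
  "mallows_sum q A = (\<Sum>\<tau>\<in>{\<tau>. \<tau> permutes A}. q ^ inv_count A \<tau>)"

definition mallows_sum_at :: "real \<Rightarrow> int set \<Rightarrow> int \<Rightarrow> int \<Rightarrow> real" where
  "mallows_sum_at q A i j = (\<Sum>\<tau>\<in>{\<tau>. \<tau> permutes A \<and> \<tau> i = j}. q ^ inv_count A \<tau>)"

text \<open>The probability that a \<open>Mallows(A, q)\<close> permutation sends \<open>i\<close>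
  to \<open>j\<close>. The quotient form lets numerator and partition function obey separate
  recursions in the right endpoint.\<close>

definition mallows_at :: "real \<Rightarrow> int set \<Rightarrow> int \<Rightarrow> int \<Rightarrow> real" where
  "mallows_at q A i j = mallows_sum_at q A i j / mallows_sum q A"

lemma finite_permutations_at: "finite A \<Longrightarrow> finite {\<tau>. \<tau> permutes A \<and> \<tau> i = j}"
  using finite_permutations[of A] by (rule rev_finite_subset) auto

lemma mallows_sum_pos:
  assumes "finite A" "0 < q" shows "0 < mallows_sum q A"
  unfolding mallows_sum_def
  using assms permutes_id[of A] by (intro sum_pos) (auto simp: finite_permutations simp del: permutes_id)

lemma mallows_sum_at_nonneg: "0 \<le> q \<Longrightarrow> 0 \<le> mallows_sum_at q A i j"
  unfolding mallows_sum_at_def by (intro sum_nonneg) auto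

lemma mallows_sum_at_le:
  "finite A \<Longrightarrow> 0 \<le> q \<Longrightarrow> mallows_sum_at q A i j \<le> mallows_sum q A"
  unfolding mallows_sum_at_def mallows_sum_def
  by (intro sum_mono2) (auto simp: finite_permutations)

lemma mallows_at_nonneg: "finite A \<Longrightarrow> 0 < q \<Longrightarrow> 0 \<le> mallows_at q A i j"
  unfolding mallows_at_def
  using mallows_sum_at_nonneg[of q A i j] mallows_sum_pos[of A q] by simp

lemma mallows_at_le_1: "finite A \<Longrightarrow> 0 < q \<Longrightarrow> mallows_at q A i j \<le> 1"
  unfolding mallows_at_def
  using mallows_sum_at_le[of A q i j] mallows_sum_pos[of A q] by simp

lemma mallows_at_eq_sum:
  "mallows_at q A i j = (\<Sum>\<pi>\<in>{\<pi>. \<pi> permutes A \<and> \<pi> i = j}. mallows_prob q A \<pi>)"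
  unfolding mallows_at_def mallows_sum_at_def mallows_prob_def mallows_sum_def
  by (simp add: sum_divide_distrib)

section \<open>Reflection symmetry of an interval\<close>

text \<open>Reversing both positions and values preserves inversions: the involution
  \<open>(i, j) \<mapsto> (a + b - j, a + b - i)\<close> matches the two sets of inverted
  pairs.\<close>

lemma inv_count_reflect:
  "inv_count {a..b} (\<lambda>x. a + b - \<pi> (a + b - x)) = inv_count {a..b} \<pi>"
  unfolding inv_count_def
  by (rule bij_betw_same_card[of "\<lambda>(i, j). (a + b - j, a + b - i)"],
      rule bij_betw_byWitness[where f' = "\<lambda>(i, j). (a + b - j, a + b - i)"]) auto

lemma permutes_reflect:
  assumes "\<pi> permutes {a..b::int}"
  shows "(\<lambda>x. a + b - \<pi> (a + b - x)) permutes {a..b}"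
proof (rule bij_imp_permutes)
  have r: "bij_betw (\<lambda>x. a + b - x) {a..b} {a..b}"
    by (rule bij_betw_byWitness[where f' = "\<lambda>x. a + b - x"]) auto
  show "bij_betw (\<lambda>x. a + b - \<pi> (a + b - x)) {a..b} {a..b}"
    using bij_betw_trans[OF bij_betw_trans[OF r permutes_imp_bij[OF assms]] r] by (simp add: o_def)
next
  fix x assume "x \<notin> {a..b}"
  then show "a + b - \<pi> (a + b - x) = x"
    using permutes_not_in[OF assms, of "a + b - x"] by auto
qed

lemma mallows_at_reflect:
  "mallows_at q {a..b} (a + b - i) (a + b - j) = mallows_at q {a..b} i j"
proof -
  let ?r = "\<lambda>\<pi> x. a + b - \<pi> (a + b - x)"
  have "mallows_sum_at q {a..b} (a + b - i) (a + b - j) = mallows_sum_at q {a..b} i j"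
    unfolding mallows_sum_at_def
    by (rule sum.reindex_bij_witness[where i = ?r and j = ?r])
       (auto simp: permutes_reflect inv_count_reflect)
  then show ?thesis by (simp add: mallows_at_def)
qed

section \<open>Exchange of two adjacent values\<close>

text \<open>Only the relative order of the values \<open>j\<close> and \<open>j + 1\<close> changes,
  and by injectivity a single pair of positions carries them.\<close>

lemma inv_count_transpose_le:
  assumes "finite A" "inj \<pi>"
  shows "inv_count A (Transposition.transpose j (j + 1) \<circ> \<pi>) \<le> inv_count A \<pi> + 1"
proof -
  let ?I = "\<lambda>\<pi>. {(x, y). x \<in> A \<and> y \<in> A \<and> x < y \<and> \<pi> x > \<pi> y}"
  let ?D = "{(x, y). \<pi> x = j \<and> \<pi> y = j + 1}"
  have fin: "finite (?I \<tau>)" for \<tau> :: "int \<Rightarrow> int"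
    by (rule finite_subset[of _ "A \<times> A"]) (use assms in auto)
  have D: "?D \<subseteq> {(inv \<pi> j, inv \<pi> (j + 1))}"
    by (auto intro!: inv_f_eq[OF assms(2), symmetric])
  \<comment> \<open>A new inversion \<open>(x, y)\<close> has \<open>\<pi> x < \<pi> y\<close> with
    the order reversed by the swap; this forces \<open>\<pi> x = j\<close> and
    \<open>\<pi> y = j + 1\<close>.\<close>
  have "?I (Transposition.transpose j (j + 1) \<circ> \<pi>) \<subseteq> ?I \<pi> \<union> ?D"
    by (auto simp: Transposition.transpose_def split: if_splits)
  then have "card (?I (Transposition.transpose j (j + 1) \<circ> \<pi>)) \<le> card (?I \<pi> \<union> ?D)"
    using fin[of \<pi>] finite_subset[OF D] by (intro card_mono) auto
  also have "\<dots> \<le> card (?I \<pi>) + card ?D" by (rule card_Un_le)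
  also have "card ?D \<le> 1" using card_mono[OF _ D] by simp
  finally show ?thesis by (simp add: inv_count_def)
qed

text \<open>Composition with the swap is an involution that matches the permutations sending
  \<open>i\<close> to \<open>k\<close> with those sending \<open>i\<close> to \<open>l\<close>; each
  weight drops by at most a factor \<open>q\<close>.\<close>

lemma mallows_sum_at_transpose_le:
  assumes q: "0 < q" "q < 1" and j: "j \<in> {a..b}" "j + 1 \<in> {a..b}"
    and jk: "(k, l) = (j, j + 1) \<or> (k, l) = (j + 1, j)"
  shows "q * mallows_sum_at q {a..b} i k \<le> mallows_sum_at q {a..b} i l"
proof -
  let ?t = "Transposition.transpose j (j + 1)"
  have "mallows_sum_at q {a..b} i l =
      (\<Sum>\<tau>\<in>{\<tau>. \<tau> permutes {a..b} \<and> \<tau> i = k}. q ^ inv_count {a..b} (?t \<circ> \<tau>))"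
    unfolding mallows_sum_at_def
    by (rule sum.reindex_bij_witness[where i = "\<lambda>\<tau>. ?t \<circ> \<tau>" and j = "\<lambda>\<tau>. ?t \<circ> \<tau>"])
       (use j jk in \<open>auto simp: o_assoc transpose_comp_involutory intro!: permutes_compose permutes_swap_id\<close>)
  also have "\<dots> \<ge> (\<Sum>\<tau>\<in>{\<tau>. \<tau> permutes {a..b} \<and> \<tau> i = k}. q * q ^ inv_count {a..b} \<tau>)"
  proof (rule sum_mono)
    fix \<tau> assume "\<tau> \<in> {\<tau>. \<tau> permutes {a..b} \<and> \<tau> i = k}"
    then have "inv_count {a..b} (?t \<circ> \<tau>) \<le> inv_count {a..b} \<tau> + 1"
      by (intro inv_count_transpose_le) (auto simp: permutes_inj)
    from power_decreasing[OF this, of q]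
    show "q * q ^ inv_count {a..b} \<tau> \<le> q ^ inv_count {a..b} (?t \<circ> \<tau>)" using q by simp
  qed
  finally show ?thesis by (simp add: mallows_sum_at_def sum_distrib_left)
qed

lemma mallows_at_neighbour:
  assumes q: "0 < q" "q < 1" and j: "j \<in> {a..b}" "k \<in> {a..b}" and jk: "k = j + 1 \<or> j = k + 1"
  shows "q * mallows_at q {a..b} i j \<le> mallows_at q {a..b} i k"
  using mallows_sum_at_transpose_le[of q "min j k" a b j k i] assms
    mallows_sum_pos[of "{a..b}" q]
  by (auto simp: mallows_at_def min_def divide_right_mono)

section \<open>Insertion of a new last position\<close>

text \<open>The cycle that moves \<open>b + 1\<close> down to \<open>m\<close> and shifts
  \<open>m..b\<close> up by one. Composed after a permutation of \<open>{a..b}\<close>, it puts the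
  value \<open>m\<close> at position \<open>b + 1\<close> and keeps the relative order of all other
  values.\<close>

definition insert_last :: "int \<Rightarrow> int \<Rightarrow> int \<Rightarrow> int" where
  "insert_last b m x = (if x = b + 1 then m else if m \<le> x \<and> x \<le> b then x + 1 else x)"

lemma permutes_insert_last:
  "m \<in> {a..b+1} \<Longrightarrow> insert_last b m permutes {a..b+1}"
  by (rule bij_imp_permutes, rule bij_betw_byWitness[where
      f' = "\<lambda>y. if y = m then b + 1 else if m < y \<and> y \<le> b + 1 then y - 1 else y"])
     (auto simp: insert_last_def)

lemma insert_last_less_iff:
  "m \<le> b + 1 \<Longrightarrow> x \<le> b \<Longrightarrow> y \<le> b \<Longrightarrow> insert_last b m x < insert_last b m y \<longleftrightarrow> x < y"
  by (auto simp: insert_last_def)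

text \<open>Old pairs keep their order, and position \<open>b + 1\<close> forms an inversion exactly
  with the \<open>b + 1 - m\<close> positions whose old value is at least \<open>m\<close>.\<close>

lemma inv_count_insert_last:
  assumes \<pi>: "\<pi> permutes {a..b}" and m: "m \<in> {a..b+1}"
  shows "inv_count {a..b+1} (insert_last b m \<circ> \<pi>) = inv_count {a..b} \<pi> + nat (b + 1 - m)"
proof -
  let ?s = "insert_last b m \<circ> \<pi>"
  let ?I = "{(x, y). x \<in> {a..b} \<and> y \<in> {a..b} \<and> x < y \<and> \<pi> x > \<pi> y}"
  let ?J = "{x \<in> {a..b}. m \<le> \<pi> x}"
  have le: "\<pi> x \<le> b" if "x \<in> {a..b}" for x
    using permutes_in_image[OF \<pi>, of x] that by simp
  have last: "?s (b + 1) = m"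
    using permutes_not_in[OF \<pi>, of "b + 1"] by (simp add: insert_last_def)
  have gt: "?s x > m \<longleftrightarrow> m \<le> \<pi> x" if "x \<in> {a..b}" for x
    using le[OF that] by (auto simp: insert_last_def)
  have lt: "?s y < ?s x \<longleftrightarrow> \<pi> y < \<pi> x" if "x \<in> {a..b}" "y \<in> {a..b}" for x y
    using insert_last_less_iff[of m b "\<pi> y" "\<pi> x"] le that m by simp
  have iff: "(x \<in> {a..b+1} \<and> y \<in> {a..b+1} \<and> x < y \<and> ?s x > ?s y)
      \<longleftrightarrow> (x, y) \<in> ?I \<union> ?J \<times> {b + 1}" for x y
  proof (cases "x \<in> {a..b} \<and> y \<in> {a..b}")
    case True
    then show ?thesis using lt[of x y] by (auto simp del: o_apply)
  next
    case False
    then show ?thesis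
    proof (cases "x \<in> {a..b} \<and> y = b + 1")
      case True
      then show ?thesis using gt[of x] last by (auto simp del: o_apply)
    qed auto
  qed
  have "\<pi> ` ?J = {m..b}"
  proof -
    have "\<pi> ` ?J = {v \<in> \<pi> ` {a..b}. m \<le> v}" by auto
    also have "\<dots> = {m..b}" using m by (auto simp: permutes_image[OF \<pi>])
    finally show ?thesis .
  qed
  then have cardJ: "card ?J = nat (b + 1 - m)"
    using card_image[of \<pi> ?J] permutes_inj_on[OF \<pi>, of ?J] by simp
  have "inv_count {a..b+1} ?s = card (?I \<union> ?J \<times> {b + 1})"
    unfolding inv_count_def using iff by (intro arg_cong[of _ _ card]) blast
  also have "\<dots> = card ?I + card (?J \<times> {b + 1})"
  proof (rule card_Un_disjoint)
    show "finite ?I" by (rule finite_subset[of _ "{a..b} \<times> {a..b}"]) auto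
    show "finite (?J \<times> {b + 1})" by (intro finite_cartesian_product finite_Collect_conjI) auto
  qed auto
  finally show ?thesis
    by (simp only: cardJ inv_count_def card_cartesian_product) simp
qed

text \<open>Each permutation of \<open>{a..b+1}\<close> arises from exactly one pair
  \<open>(m, \<pi>)\<close>: \<open>m\<close> is its value at \<open>b + 1\<close>, and undoing the
  insertion recovers \<open>\<pi>\<close>.\<close>

lemma sum_permutes_insert_last:
  assumes "a \<le> b + 1"
  shows "(\<Sum>\<tau>\<in>{\<tau>. \<tau> permutes {a..b+1}}. f \<tau>) =
    (\<Sum>m\<in>{a..b+1}. \<Sum>\<pi>\<in>{\<pi>. \<pi> permutes {a..b}}. f (insert_last b m \<circ> \<pi>))"
proof -
  have "bij_betw (\<lambda>(m, \<pi>). insert_last b m \<circ> \<pi>)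
      ({a..b+1} \<times> {\<pi>. \<pi> permutes {a..b}}) {\<tau>. \<tau> permutes {a..b+1}}"
  proof (rule bij_betw_byWitness[where
        f' = "\<lambda>\<tau>. (\<tau> (b + 1), inv (insert_last b (\<tau> (b + 1))) \<circ> \<tau>)"])
    have inj: "inj (insert_last b m)" if "m \<in> {a..b+1}" for m
      using permutes_inj[OF permutes_insert_last[OF that]] .
    have last: "\<pi> (b + 1) = b + 1" if "\<pi> permutes {a..b}" for \<pi>
      using permutes_not_in[OF that, of "b + 1"] by simp
    have il: "insert_last b m (b + 1) = m" for m by (simp add: insert_last_def)
    show "\<forall>p\<in>{a..b+1} \<times> {\<pi>. \<pi> permutes {a..b}}.
        (\<lambda>\<tau>. (\<tau> (b + 1), inv (insert_last b (\<tau> (b + 1))) \<circ> \<tau>))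
          ((\<lambda>(m, \<pi>). insert_last b m \<circ> \<pi>) p) = p"
      using inj by (auto simp: last il o_assoc[symmetric] fun_eq_iff)
    have mem: "\<tau> (b + 1) \<in> {a..b+1}" if "\<tau> permutes {a..b+1}" for \<tau>
      using permutes_in_image[OF that, of "b + 1"] assms by simp
    show "\<forall>\<tau>\<in>{\<tau>. \<tau> permutes {a..b+1}}. (\<lambda>(m, \<pi>). insert_last b m \<circ> \<pi>)
        (\<tau> (b + 1), inv (insert_last b (\<tau> (b + 1))) \<circ> \<tau>) = \<tau>"
      using surj_f_inv_f[OF permutes_surj[OF permutes_insert_last[OF mem]]]
      by (auto simp: fun_eq_iff)
    show "(\<lambda>(m, \<pi>). insert_last b m \<circ> \<pi>) ` ({a..b+1} \<times> {\<pi>. \<pi> permutes {a..b}})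
        \<subseteq> {\<tau>. \<tau> permutes {a..b+1}}"
      by (auto intro!: permutes_compose permutes_insert_last intro: permutes_subset)
    show "(\<lambda>\<tau>. (\<tau> (b + 1), inv (insert_last b (\<tau> (b + 1))) \<circ> \<tau>)) ` {\<tau>. \<tau> permutes {a..b+1}}
        \<subseteq> {a..b+1} \<times> {\<pi>. \<pi> permutes {a..b}}"
    proof clarify
      fix \<tau> assume \<tau>: "\<tau> permutes {a..b+1}"
      let ?m = "\<tau> (b + 1)"
      have "inv (insert_last b ?m) \<circ> \<tau> permutes {a..b+1}"
        using \<tau> mem[OF \<tau>] by (intro permutes_compose permutes_inv permutes_insert_last)
      \<comment> \<open>Undoing the insertion sends \<open>m\<close> back to \<open>b + 1\<close>,
        so the result fixes \<open>b + 1\<close> and permutes the smaller interval.\<close>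
      then have "inv (insert_last b ?m) \<circ> \<tau> permutes {a..b}"
      proof (rule permutes_superset)
        fix x assume "x \<in> {a..b+1} - {a..b}"
        then have "x = b + 1" by auto
        then show "(inv (insert_last b ?m) \<circ> \<tau>) x = x"
          using inv_f_f[OF inj[OF mem[OF \<tau>]], of "b + 1"] by (simp add: il)
      qed
      then show "?m \<in> {a..b+1} \<and> inv (insert_last b ?m) \<circ> \<tau> \<in> {\<pi>. \<pi> permutes {a..b}}"
        using mem[OF \<tau>] by simp
    qed
  qed
  from sum.reindex_bij_betw[OF this, of f]
  show ?thesis by (simp add: sum.cartesian_product case_prod_unfold)
qed

lemma mallows_sum_insert_last:
  assumes "a \<le> b + 1"
  shows "mallows_sum q {a..b+1} = (\<Sum>m\<in>{a..b+1}. q ^ nat (b + 1 - m)) * mallows_sum q {a..b}"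
  unfolding mallows_sum_def sum_permutes_insert_last[OF assms]
  by (auto simp: sum_product inv_count_insert_last power_add mult.commute intro!: sum.cong)

text \<open>With the constraint as an indicator, the sum runs over all permutations and the
  insertion bijection applies.\<close>

lemma mallows_sum_at_conv:
  "finite A \<Longrightarrow> mallows_sum_at q A i j =
    (\<Sum>\<tau>\<in>{\<tau>. \<tau> permutes A}. of_bool (\<tau> i = j) * q ^ inv_count A \<tau>)"
  unfolding mallows_sum_at_def
  by (rule sum.mono_neutral_cong_left) (auto simp: finite_permutations)

text \<open>An inserted value \<open>m > j\<close> leaves the old value \<open>j\<close> in place,
  and \<open>m < j\<close> lifts the old value \<open>j - 1\<close> to \<open>j\<close>. For
  \<open>m = j\<close> the value \<open>j\<close> sits at \<open>b + 1\<close>, hence not at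
  \<open>i\<close>.\<close>

lemma mallows_sum_at_insert_last:
  assumes i: "i \<in> {a..b}" and j: "j \<in> {a..b}"
  shows "mallows_sum_at q {a..b+1} i j =
    (\<Sum>m\<in>{j<..b+1}. q ^ nat (b + 1 - m)) * mallows_sum_at q {a..b} i j +
    (\<Sum>m\<in>{a..<j}. q ^ nat (b + 1 - m)) * mallows_sum_at q {a..b} i (j - 1)"
proof -
  let ?w = "\<lambda>m. q ^ nat (b + 1 - m)"
  let ?S = "mallows_sum_at q {a..b} i"
  have "mallows_sum_at q {a..b+1} i j = (\<Sum>m\<in>{a..b+1}. \<Sum>\<pi>\<in>{\<pi>. \<pi> permutes {a..b}}.
      of_bool (insert_last b m (\<pi> i) = j) * (q ^ inv_count {a..b} \<pi> * ?w m))"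
    using i j by (auto simp: mallows_sum_at_conv sum_permutes_insert_last inv_count_insert_last
        power_add intro!: sum.cong)
  also have "\<dots> = (\<Sum>m\<in>{a..b+1}. (if j < m then ?w m * ?S j else 0)
      + (if m < j then ?w m * ?S (j - 1) else 0))"
  proof (rule sum.cong[OF refl])
    fix m assume m: "m \<in> {a..b+1}"
    have "of_bool (insert_last b m (\<pi> i) = j) =
        (of_bool (j < m \<and> \<pi> i = j) + of_bool (m < j \<and> \<pi> i = j - 1) :: real)"
      if "\<pi> permutes {a..b}" for \<pi>
      using permutes_in_image[OF that, of i] i j m by (auto simp: insert_last_def)
    then have "(\<Sum>\<pi>\<in>{\<pi>. \<pi> permutes {a..b}}.
        of_bool (insert_last b m (\<pi> i) = j) * (q ^ inv_count {a..b} \<pi> * ?w m)) =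
      (\<Sum>\<pi>\<in>{\<pi>. \<pi> permutes {a..b}}.
        of_bool (j < m) * ?w m * (of_bool (\<pi> i = j) * q ^ inv_count {a..b} \<pi>)
        + of_bool (m < j) * ?w m * (of_bool (\<pi> i = j - 1) * q ^ inv_count {a..b} \<pi>))"
      by (intro sum.cong) (auto simp: algebra_simps)
    also have "\<dots> = (if j < m then ?w m * ?S j else 0) + (if m < j then ?w m * ?S (j - 1) else 0)"
      by (simp add: mallows_sum_at_conv sum.distrib flip: sum_distrib_left)
    finally show "(\<Sum>\<pi>\<in>{\<pi>. \<pi> permutes {a..b}}.
        of_bool (insert_last b m (\<pi> i) = j) * (q ^ inv_count {a..b} \<pi> * ?w m)) = \<dots>" .
  qed
  also have "\<dots> = (\<Sum>m\<in>{a..b+1} \<inter> {m. j < m}. ?w m * ?S j)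
      + (\<Sum>m\<in>{a..b+1} \<inter> {m. m < j}. ?w m * ?S (j - 1))"
    by (simp add: sum.distrib sum.inter_restrict)
  also have "{a..b+1} \<inter> {m. j < m} = {j<..b+1}" using j by auto
  also have "{a..b+1} \<inter> {m. m < j} = {a..<j}" using j by auto
  finally show ?thesis by (simp add: sum_distrib_right)
qed

text \<open>Factoring out the largest weight and shifting the index by \<open>b + 1 - j\<close>
  turns the tail into part of the full geometric sum.\<close>

lemma geometric_tail_le:
  fixes q :: real
  assumes "0 < q" and "j \<le> b + 1"
  shows "(\<Sum>m\<in>{a..j}. q ^ nat (b + 1 - m)) \<le>
    q ^ nat (b + 1 - j) * (\<Sum>m\<in>{a..b+1}. q ^ nat (b + 1 - m))"
proof -
  have "(\<Sum>m\<in>{a..j}. q ^ nat (b + 1 - m)) = (\<Sum>m\<in>{a..j}. q ^ nat (b + 1 - j) * q ^ nat (j - m))"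
    using assms(2) by (intro sum.cong refl) (auto simp: algebra_simps simp flip: power_add nat_add_distrib)
  also have "\<dots> = q ^ nat (b + 1 - j) * (\<Sum>m\<in>{a..j}. q ^ nat (j - m))"
    by (simp add: sum_distrib_left)
  also have "(\<Sum>m\<in>{a..j}. q ^ nat (j - m)) = (\<Sum>m\<in>{a+(b+1-j)..b+1}. q ^ nat (b + 1 - m))"
    by (rule sum.reindex_bij_witness[where i = "\<lambda>m. m - (b + 1 - j)" and j = "\<lambda>m. m + (b + 1 - j)"])
       auto
  also have "\<dots> \<le> (\<Sum>m\<in>{a..b+1}. q ^ nat (b + 1 - m))"
    using assms by (intro sum_mono2) auto
  finally show ?thesis using assms(1) by simp
qed

text \<open>The new last value \<open>m\<close> has probability proportional to
  \<open>q ^ (b + 1 - m)\<close>, so \<open>m \<le> j\<close> has probability at most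
  \<open>q ^ (b + 1 - j)\<close>; when \<open>m > j\<close>, whether \<open>i\<close> is sent to
  \<open>j\<close> is unaffected.\<close>

lemma mallows_at_insert_last:
  assumes q: "0 < q" and i: "i \<in> {a..b}" and j: "j \<in> {a..b}"
  shows "(1 - q ^ nat (b + 1 - j)) * mallows_at q {a..b} i j \<le> mallows_at q {a..b+1} i j"
    and "mallows_at q {a..b+1} i j \<le> mallows_at q {a..b} i j + q ^ nat (b + 1 - j)"
proof -
  let ?w = "\<lambda>m. q ^ nat (b + 1 - m)"
  define W where "W = (\<Sum>m\<in>{a..b+1}. ?w m)"
  define U where "U = (\<Sum>m\<in>{j<..b+1}. ?w m)"
  define L where "L = (\<Sum>m\<in>{a..<j}. ?w m)"
  define P where "P = mallows_at q {a..b} i j"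
  \<comment> \<open>For \<open>j = a\<close> the value \<open>j - 1\<close> leaves the interval, but
    then \<open>L\<close> is an empty sum; the estimates use only
    \<open>0 \<le> P' \<le> 1\<close>.\<close>
  define P' where "P' = mallows_at q {a..b} i (j - 1)"
  define \<delta> where "\<delta> = q ^ nat (b + 1 - j)"
  have W: "W > 0" unfolding W_def using i q by (intro sum_pos) auto
  \<comment> \<open>The term \<open>m = j\<close> counts in \<open>W\<close> but in neither
    \<open>U\<close> nor \<open>L\<close>.\<close>
  have ULj: "W = U + (L + ?w j)"
  proof -
    have "{a..b+1} = {a..j} \<union> {j<..b+1}" "{a..j} = insert j {a..<j}" using j by auto
    moreover have "{a..j} \<inter> {j<..b+1} = {}" by auto
    ultimately show ?thesis unfolding W_def U_def L_def
      using sum.union_disjoint[of "{a..j}" "{j<..b+1}" ?w] by (simp add: add.commute)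
  qed
  have tail: "L + ?w j \<le> \<delta> * W"
  proof -
    have "{a..j} = insert j {a..<j}" using j by auto
    then show ?thesis using geometric_tail_le[OF q, of j b a] j
      by (simp add: W_def L_def \<delta>_def add.commute)
  qed
  have L0: "0 \<le> L" unfolding L_def using q by (intro sum_nonneg) auto
  have U0: "0 \<le> U" unfolding U_def using q by (intro sum_nonneg) auto
  have P: "0 \<le> P" "0 \<le> P'" "P' \<le> 1"
    using q by (auto simp: P_def P'_def mallows_at_nonneg mallows_at_le_1)
  have Z: "mallows_sum q {a..b+1} = W * mallows_sum q {a..b}"
    using i by (simp add: mallows_sum_insert_last W_def)
  have S: "mallows_sum_at q {a..b+1} i j =
      U * mallows_sum_at q {a..b} i j + L * mallows_sum_at q {a..b} i (j - 1)"
    using mallows_sum_at_insert_last[OF i j] by (simp add: U_def L_def)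
  have eq: "mallows_at q {a..b+1} i j = (U * P + L * P') / W"
    using mallows_sum_pos[of "{a..b}" q] q W
    unfolding mallows_at_def[of q "{a..b+1}"] S Z
    by (simp add: mallows_at_def P_def P'_def field_simps)
  have "(1 - \<delta>) * P * W \<le> U * P + L * P'"
  proof -
    have "(1 - \<delta>) * W \<le> U" using ULj tail by (simp add: algebra_simps)
    from mult_right_mono[OF this P(1)] show ?thesis
      using mult_nonneg_nonneg[OF L0 P(2)] by (simp add: algebra_simps)
  qed
  then show "(1 - q ^ nat (b + 1 - j)) * mallows_at q {a..b} i j \<le> mallows_at q {a..b+1} i j"
    using W unfolding eq P_def[symmetric] \<delta>_def[symmetric] by (simp add: field_simps)
  have "U * P + L * P' \<le> (P + \<delta>) * W"
  proof -
    have "?w j > 0" using q by simp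
    then have "U \<le> W" "L \<le> \<delta> * W" using ULj L0 tail by linarith+
    then have "U * P \<le> W * P" "L * P' \<le> \<delta> * W"
      using P L0 mult_right_mono[of U W P] mult_left_le[of P' L] by auto
    then show ?thesis by (simp add: algebra_simps)
  qed
  then show "mallows_at q {a..b+1} i j \<le> mallows_at q {a..b} i j + q ^ nat (b + 1 - j)"
    using W unfolding eq P_def[symmetric] \<delta>_def[symmetric] by (simp add: field_simps)
qed

section \<open>Lower bound for the probability of fixing 0\<close>

text \<open>The last position is fixed exactly when \<open>m = b + 1\<close>, which has weight 1 out
  of a geometric sum bounded by \<open>1 / (1 - q)\<close>.\<close>

lemma mallows_at_last_ge:
  assumes q: "0 < q" "q < 1" and ab: "a \<le> b + 1"
  shows "1 - q \<le> mallows_at q {a..b+1} (b + 1) (b + 1)"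
proof -
  define W where "W = (\<Sum>m\<in>{a..b+1}. q ^ nat (b + 1 - m))"
  have W: "W > 0" unfolding W_def using ab q by (intro sum_pos) auto
  have "mallows_sum_at q {a..b+1} (b + 1) (b + 1) \<ge> mallows_sum q {a..b}"
  proof -
    have *: "mallows_sum_at q {a..b+1} (b + 1) (b + 1) =
      (\<Sum>m\<in>{a..b+1}. \<Sum>\<pi>\<in>{\<pi>. \<pi> permutes {a..b}}.
        of_bool (m = b + 1) * q ^ inv_count {a..b+1} (insert_last b m \<circ> \<pi>))"
    proof -
      have "insert_last b m (\<pi> (b + 1)) = m" if "\<pi> permutes {a..b}" for \<pi> m
        using permutes_not_in[OF that, of "b + 1"] by (simp add: insert_last_def)
      then show ?thesis using ab
        by (auto simp: mallows_sum_at_conv sum_permutes_insert_last intro!: sum.cong)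
    qed
    also have "\<dots> = (\<Sum>m\<in>{a..b+1}. of_bool (m = b + 1) * mallows_sum q {a..b})"
      by (auto simp: mallows_sum_def inv_count_insert_last sum_distrib_left intro!: sum.cong)
    also have "\<dots> = (\<Sum>m\<in>{a..b+1}. if m = b + 1 then mallows_sum q {a..b} else 0)"
      by (intro sum.cong) auto
    also have "\<dots> = mallows_sum q {a..b}" using ab by simp
    finally show ?thesis by simp
  qed
  moreover have "mallows_sum q {a..b+1} = W * mallows_sum q {a..b}"
    using ab by (simp add: mallows_sum_insert_last W_def)
  ultimately have "mallows_at q {a..b+1} (b + 1) (b + 1) \<ge> 1 / W"
    using mallows_sum_pos[of "{a..b}" q] q W
    by (simp add: mallows_at_def field_simps del: add.commute)
  moreover have "1 - q \<le> 1 / W"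
  proof -
    have "W = (\<Sum>t<nat (b + 2 - a). q ^ t)"
      unfolding W_def
      by (rule sum.reindex_bij_witness[where i = "\<lambda>t. b + 1 - int t" and j = "\<lambda>m. nat (b + 1 - m)"])
         auto
    then have "(1 - q) * W = 1 - q ^ nat (b + 2 - a)"
      using one_diff_power_eq[of q "nat (b + 2 - a)"] by simp
    then have "(1 - q) * W \<le> 1" using q by simp
    then show ?thesis using W by (simp add: field_simps)
  qed
  ultimately show ?thesis by (rule order_trans[rotated])
qed

text \<open>The extra term \<open>q ^ (k + 1)\<close> makes the induction on the right endpoint
  work. For \<open>k = 0\<close> the position 0 is the last one and the bound is
  \<open>1 - q\<close>. With \<open>x = q ^ (k + 1)\<close>, the step
  \<open>(1 - x) * (1 - 2 * q + x) \<ge> 1 - 2 * q + q * x\<close> reduces to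
  \<open>x \<le> q\<close>.\<close>

lemma mallows_at_diag_ge:
  assumes q: "0 < q" "q < 1"
  shows "1 - 2 * q + q ^ (k + 1) \<le> mallows_at q {- int n..int k} 0 0"
proof (induction k)
  case 0
  then show ?case using mallows_at_last_ge[OF q, of "- int n" "-1"] by simp
next
  case (Suc k)
  let ?P = "mallows_at q {- int n..int k} 0 0"
  have e: "nat (int k + 1) = k + 1" "{- int n..int (Suc k)} = {- int n..int k + 1}" by auto
  have "q ^ (k + 1) \<le> q" using q by (simp add: mult_left_le power_le_one)
  then have "q ^ (k + 1) * (1 - 2 * q + q ^ (k + 1)) \<le> q ^ (k + 1) * (1 - q)"
    using q by (intro mult_left_mono) auto
  then have "1 - 2 * q + q ^ (Suc k + 1) \<le> (1 - q ^ (k + 1)) * (1 - 2 * q + q ^ (k + 1))"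
    by (simp add: algebra_simps)
  also have "\<dots> \<le> (1 - q ^ (k + 1)) * ?P"
    using Suc q by (intro mult_left_mono) (auto simp: power_le_one mult_le_one)
  also have "\<dots> \<le> mallows_at q {- int n..int k + 1} 0 0"
    using mallows_at_insert_last(1)[OF q(1), of 0 "- int n" "int k" 0] by (simp add: e(1))
  finally show ?case by (simp only: e(2))
qed

section \<open>Patterns: measurability and bijectivity\<close>

lemma measurable_card_Collect:
  assumes "finite A" and "\<And>b. b \<in> A \<Longrightarrow> Measurable.pred M (P b)"
  shows "(\<lambda>\<omega>. card {b \<in> A. P b \<omega>}) \<in> measurable M (count_space UNIV)"
  using assms
proof (induction A rule: finite_induct)
  case (insert a A)
  have [measurable]: "Measurable.pred M (P a)"
    "(\<lambda>\<omega>. card {b \<in> A. P b \<omega>}) \<in> measurable M (count_space UNIV)"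
    using insert by auto
  have "{b \<in> insert a A. P b \<omega>} = (if P a \<omega> then insert a else id) {b \<in> A. P b \<omega>}" for \<omega>
    by auto
  then have "card {b \<in> insert a A. P b \<omega>} =
      (if P a \<omega> then Suc (card {b \<in> A. P b \<omega>}) else card {b \<in> A. P b \<omega>})" for \<omega>
    using insert.hyps by simp
  then show ?case by simp
qed simp

lemma measurable_pattern:
  assumes Sg: "\<And>i. (\<lambda>\<omega>. Sg \<omega> i) \<in> measurable M (count_space UNIV)" and "finite A"
  shows "(\<lambda>\<omega>. pattern (Sg \<omega>) A i) \<in> measurable M (count_space UNIV)"
proof (cases "i \<in> A")
  case True
  note [measurable] = Sg
  have "(\<lambda>\<omega>. card {b \<in> A. Sg \<omega> b < Sg \<omega> i}) \<in> measurable M (count_space UNIV)"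
    using \<open>finite A\<close> by (rule measurable_card_Collect) measurable
  from measurable_compose[OF this, of "\<lambda>k. sorted_list_of_set A ! k" "count_space UNIV"]
  show ?thesis using True by (simp add: pattern_def)
qed (simp add: pattern_def)

lemma pattern_permutes:
  assumes "inj \<sigma>" and A: "finite A"
  shows "pattern \<sigma> A permutes A"
proof (rule bij_imp_permutes)
  let ?c = "\<lambda>a. card {b \<in> A. \<sigma> b < \<sigma> a}"
  have lt: "?c a < length (sorted_list_of_set A)" if "a \<in> A" for a
    using A that by (auto intro!: psubset_card_mono)
  have mono: "?c a < ?c a'" if "\<sigma> a < \<sigma> a'" "a \<in> A" for a a'
    using A that by (intro psubset_card_mono) auto
  \<comment> \<open>The rank \<open>?c\<close> is strictly increasing in \<open>\<sigma> a\<close>,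
    so equal ranks force equal values of \<open>\<sigma>\<close>.\<close>
  have "inj_on (pattern \<sigma> A) A"
  proof (rule inj_onI)
    fix a a' assume a: "a \<in> A" "a' \<in> A" and "pattern \<sigma> A a = pattern \<sigma> A a'"
    then have "?c a = ?c a'"
      using nth_eq_iff_index_eq[OF distinct_sorted_list_of_set lt lt]
      by (simp add: pattern_def)
    then have "\<sigma> a = \<sigma> a'"
      using mono[of a a'] mono[of a' a] a by (cases "\<sigma> a" "\<sigma> a'" rule: linorder_cases) auto
    then show "a = a'" using \<open>inj \<sigma>\<close> by (simp add: inj_eq)
  qed
  moreover have "pattern \<sigma> A ` A \<subseteq> A"
    using nth_mem[OF lt] A by (auto simp: pattern_def)
  ultimately show "bij_betw (pattern \<sigma> A) A A"
    using endo_inj_surj[OF A] by (auto simp: bij_betw_def)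
qed (simp add: pattern_def)

section \<open>One-point probabilities of the bi-infinite measure\<close>

text \<open>Here \<open>q\<close> is the Mallows parameter itself, below 1; the main theorem
  instantiates it with \<open>1 / q\<close>.\<close>

locale bi_infinite_mallows = prob_space M for M :: "'w measure" +
  fixes q :: real and Sg :: "'w \<Rightarrow> int \<Rightarrow> int"
  assumes law: "bi_mallows q M Sg" and q_pos: "0 < q" and q_less_1: "q < 1"
begin

lemma measurable_Sg [measurable]: "(\<lambda>\<omega>. Sg \<omega> i) \<in> measurable M (count_space UNIV)"
  using law by (simp add: bi_mallows_def)

lemma measurable_pattern_Sg [measurable]:
  "finite A \<Longrightarrow> (\<lambda>\<omega>. pattern (Sg \<omega>) A i) \<in> measurable M (count_space UNIV)"
  by (rule measurable_pattern) auto

definition p :: "int \<Rightarrow> int \<Rightarrow> real" where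
  "p i j = prob {\<omega> \<in> space M. Sg \<omega> i = j}"

lemma prob_pattern_eq:
  "prob {\<omega> \<in> space M. pattern (Sg \<omega>) {a..b} i = j} = mallows_at q {a..b} i j"
proof -
  let ?S = "{\<pi>. \<pi> permutes {a..b} \<and> \<pi> i = j}"
  let ?E = "\<lambda>\<pi>. {\<omega> \<in> space M. pattern (Sg \<omega>) {a..b} = \<pi>}"
  have perm: "pattern (Sg \<omega>) {a..b} permutes {a..b}" if "\<omega> \<in> space M" for \<omega>
    using that law by (intro pattern_permutes) (auto simp: bi_mallows_def bij_is_inj)
  have "?E \<pi> \<in> events" if "\<pi> permutes {a..b}" for \<pi>
  proof -
    \<comment> \<open>Both sides fix every point outside \<open>{a..b}\<close>, so equality of
      functions is a finite conjunction of measurable events.\<close>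
    have "?E \<pi> = {\<omega> \<in> space M. \<forall>i\<in>{a..b}. pattern (Sg \<omega>) {a..b} i = \<pi> i}"
      using permutes_not_in[OF that] permutes_not_in[OF perm] by (fastforce simp: fun_eq_iff)
    also have "\<dots> \<in> events" by measurable
    finally show ?thesis .
  qed
  then have "prob (\<Union>\<pi>\<in>?S. ?E \<pi>) = (\<Sum>\<pi>\<in>?S. prob (?E \<pi>))"
    by (intro finite_measure_finite_Union finite_permutations_at)
       (auto simp: disjoint_family_on_def)
  also have "(\<Union>\<pi>\<in>?S. ?E \<pi>) = {\<omega> \<in> space M. pattern (Sg \<omega>) {a..b} i = j}"
    using perm by auto
  also have "(\<Sum>\<pi>\<in>?S. prob (?E \<pi>)) = (\<Sum>\<pi>\<in>?S. mallows_prob q {a..b} \<pi>)"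
    using law by (intro sum.cong) (auto simp: bi_mallows_def)
  finally show ?thesis by (simp add: mallows_at_eq_sum)
qed

text \<open>Almost surely the indicators of the pattern events are eventually equal to that of the
  limit event; dominated convergence with bound 1 finishes.\<close>

lemma mallows_at_tendsto: "(\<lambda>n. mallows_at q {- int n..int n} i j) \<longlonglongrightarrow> p i j"
proof -
  let ?s = "\<lambda>n \<omega>. indicator {\<omega> \<in> space M. pattern (Sg \<omega>) {- int n..int n} i = j} \<omega> :: real"
  let ?f = "\<lambda>\<omega>. indicator {\<omega> \<in> space M. Sg \<omega> i = j} \<omega> :: real"
  have "AE \<omega> in M. \<forall>i. \<exists>N. \<forall>n\<ge>N. pattern (Sg \<omega>) {- int n..int n} i = Sg \<omega> i"
    using law by (simp add: bi_mallows_def)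
  then have "AE \<omega> in M. (\<lambda>n. ?s n \<omega>) \<longlonglongrightarrow> ?f \<omega>"
  proof eventually_elim
    case (elim \<omega>)
    then obtain N where "\<And>n. n \<ge> N \<Longrightarrow> pattern (Sg \<omega>) {- int n..int n} i = Sg \<omega> i" by blast
    then have "eventually (\<lambda>n. ?s n \<omega> = ?f \<omega>) sequentially"
      by (auto simp: indicator_def intro!: eventually_sequentiallyI[of N])
    then show ?case by (rule tendsto_eventually)
  qed
  then have "(\<lambda>n. integral\<^sup>L M (?s n)) \<longlonglongrightarrow> integral\<^sup>L M ?f"
    by (intro integral_dominated_convergence[where w = "\<lambda>_. 1"]) auto
  moreover have "integral\<^sup>L M (?s n) = mallows_at q {- int n..int n} i j" for n
    by (simp add: prob_pattern_eq[symmetric])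
  ultimately show ?thesis by (simp add: p_def)
qed

text \<open>The defining convergence covers only the intervals \<open>{-n..n}\<close>; one insertion
  at the right end costs an error \<open>q ^ (n + 1 - j)\<close>, which vanishes in the
  limit.\<close>

lemma mallows_at_tendsto_shifted: "(\<lambda>n. mallows_at q {- int n..int n + 1} i j) \<longlonglongrightarrow> p i j"
proof (rule tendsto_sandwich)
  let ?P = "\<lambda>n. mallows_at q {- int n..int n} i j"
  let ?\<delta> = "\<lambda>n. q ^ nat (int n + 1 - j)"
  have "filterlim (\<lambda>n. nat (int n + 1 - j)) at_top sequentially"
    unfolding filterlim_at_top eventually_sequentially
  proof
    fix Z show "\<exists>N. \<forall>n\<ge>N. Z \<le> nat (int n + 1 - j)"
      by (rule exI[of _ "nat (int Z + j)"]) auto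
  qed
  from filterlim_compose[OF LIMSEQ_power_zero[of q] this] q_pos q_less_1
  have \<delta>: "?\<delta> \<longlonglongrightarrow> 0" by simp
  show "(\<lambda>n. (1 - ?\<delta> n) * ?P n) \<longlonglongrightarrow> p i j"
    using tendsto_mult[OF tendsto_diff[OF tendsto_const[of 1] \<delta>] mallows_at_tendsto[of i j]] by simp
  show "(\<lambda>n. ?P n + ?\<delta> n) \<longlonglongrightarrow> p i j"
    using tendsto_add[OF mallows_at_tendsto[of i j] \<delta>] by simp
  have ev: "eventually (\<lambda>n. i \<in> {- int n..int n} \<and> j \<in> {- int n..int n}) sequentially"
    by (rule eventually_sequentiallyI[of "nat \<bar>i\<bar> + nat \<bar>j\<bar>"]) auto
  show "eventually (\<lambda>n. (1 - ?\<delta> n) * ?P n \<le> mallows_at q {- int n..int n + 1} i j) sequentially"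
    using ev by eventually_elim (intro mallows_at_insert_last q_pos; simp)
  show "eventually (\<lambda>n. mallows_at q {- int n..int n + 1} i j \<le> ?P n + ?\<delta> n) sequentially"
    using ev by eventually_elim (intro mallows_at_insert_last q_pos; simp)
qed

section \<open>Symmetries and neighbour bounds for the limit\<close>

text \<open>The endpoints of \<open>{-n..n}\<close> add up to 0 and those of
  \<open>{-n..n+1}\<close> to 1, which gives the centres of the two reflections.\<close>

lemma p_reflect: "p (- i) (- j) = p i j" "p (1 - i) (1 - j) = p i j"
proof -
  have "mallows_at q {- int n..int n} (- i) (- j) = mallows_at q {- int n..int n} i j" for n
    using mallows_at_reflect[of q "- int n" "int n" i j] by simp
  with mallows_at_tendsto[of "- i" "- j"] show "p (- i) (- j) = p i j"
    by (simp add: LIMSEQ_unique[OF _ mallows_at_tendsto])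
  have "mallows_at q {- int n..int n + 1} (1 - i) (1 - j) = mallows_at q {- int n..int n + 1} i j" for n
    using mallows_at_reflect[of q "- int n" "int n + 1" i j] by simp
  with mallows_at_tendsto_shifted[of "1 - i" "1 - j"] show "p (1 - i) (1 - j) = p i j"
    by (simp add: LIMSEQ_unique[OF _ mallows_at_tendsto_shifted])
qed

text \<open>The two reflections compose to a shift by one.\<close>

lemma p_stationary: "p (i + k) (j + k) = p i j"
proof -
  have step: "p (i + 1) (j + 1) = p i j" for i j
    using p_reflect(2)[of "- i" "- j"] p_reflect(1)[of i j] by (simp add: add.commute)
  show ?thesis
  proof (induction k rule: int_induct[where k = 0])
    case (step1 k)
    then show ?case using step[of "i + k" "j + k"] by (simp add: add.assoc)
  next
    case (step2 k)
    then show ?case using step[of "i + (k - 1)" "j + (k - 1)"] by simp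
  qed simp
qed

lemma p_neighbour:
  assumes "k = j + 1 \<or> j = k + 1"
  shows "q * p i j \<le> p i k"
proof (rule tendsto_le)
  show "(\<lambda>n. q * mallows_at q {- int n..int n} i j) \<longlonglongrightarrow> q * p i j"
    by (intro tendsto_intros mallows_at_tendsto)
  show "(\<lambda>n. mallows_at q {- int n..int n} i k) \<longlonglongrightarrow> p i k"
    by (rule mallows_at_tendsto)
  have "eventually (\<lambda>n. j \<in> {- int n..int n} \<and> k \<in> {- int n..int n}) sequentially"
    by (rule eventually_sequentiallyI[of "nat \<bar>j\<bar> + nat \<bar>k\<bar>"]) auto
  then show "eventually (\<lambda>n. q * mallows_at q {- int n..int n} i j
      \<le> mallows_at q {- int n..int n} i k) sequentially"
    by eventually_elim (use assms q_pos q_less_1 in \<open>intro mallows_at_neighbour; simp\<close>)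
qed simp

lemma p_diag_ge: "1 - 2 * q \<le> p 0 0"
proof (rule LIMSEQ_le_const[OF mallows_at_tendsto], intro exI allI impI)
  fix n :: nat
  have "0 \<le> q ^ (n + 1)" using q_pos by simp
  then show "1 - 2 * q \<le> mallows_at q {- int n..int n} 0 0"
    using mallows_at_diag_ge[OF q_pos q_less_1, of n n] by linarith
qed

section \<open>Parity of the image of 0 and expected fixed points\<close>

text \<open>Values of the parity of \<open>c\<close> are enumerated as \<open>c - 2 * k\<close>
  because stationarity turns \<open>p k (c - k)\<close> into \<open>p 0 (c - 2 * k)\<close>.\<close>

lemma emeasure_parity:
  "emeasure M {\<omega> \<in> space M. even (Sg \<omega> i - c)} =
    (\<integral>\<^sup>+k. ennreal (p i (c - 2 * k)) \<partial>count_space UNIV)"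
proof -
  let ?X = "\<lambda>k. {\<omega> \<in> space M. Sg \<omega> i = c - 2 * k}"
  have "even (x - c) \<longleftrightarrow> (\<exists>k. x = c - 2 * k)" for x
  proof
    assume "even (x - c)"
    then obtain l where "x - c = 2 * l" ..
    then have "x = c - 2 * (- l)" by simp
    then show "\<exists>k. x = c - 2 * k" ..
  qed auto
  then have "{\<omega> \<in> space M. even (Sg \<omega> i - c)} = (\<Union>(range ?X))" by auto
  also have "emeasure M \<dots> = (\<integral>\<^sup>+k. emeasure M (?X k) \<partial>count_space UNIV)"
    by (rule emeasure_UN_countable) (auto simp: disjoint_family_on_def)
  finally show ?thesis by (simp add: p_def emeasure_eq_measure)
qed

text \<open>By stationarity the expected number of solutions of \<open>Sg i + i = c\<close> is a sum over
  the positions \<open>c - 2 i\<close> of \<open>Sg 0\<close>.\<close>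

lemma nn_integral_C1_reflect:
  "(\<integral>\<^sup>+\<omega>. C1 ((\<lambda>x. c - x) \<circ> Sg \<omega>) \<partial>M) =
    ennreal (prob {\<omega> \<in> space M. even (Sg \<omega> 0 - c)})"
proof -
  have "C1 \<pi> = (\<integral>\<^sup>+i. indicator {i. \<pi> i = i} i \<partial>count_space UNIV)" for \<pi>
    unfolding C1_def by simp
  then have "(\<integral>\<^sup>+\<omega>. C1 ((\<lambda>x. c - x) \<circ> Sg \<omega>) \<partial>M) =
      (\<integral>\<^sup>+\<omega>. \<integral>\<^sup>+i. indicator {\<omega> \<in> space M. Sg \<omega> i = c - i} \<omega> \<partial>count_space UNIV \<partial>M)"
    by (intro nn_integral_cong) (auto simp: indicator_def intro!: nn_integral_cong)
  also have "\<dots> = (\<integral>\<^sup>+i. \<integral>\<^sup>+\<omega>. indicator {\<omega> \<in> space M. Sg \<omega> i = c - i} \<omega> \<partial>M \<partial>count_space UNIV)"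
    by (rule nn_integral_count_space_nn_integral) auto
  also have "\<dots> = (\<integral>\<^sup>+i. ennreal (p i (c - i)) \<partial>count_space UNIV)"
    by (simp add: p_def emeasure_eq_measure)
  also have "\<dots> = (\<integral>\<^sup>+i. ennreal (p 0 (c - 2 * i)) \<partial>count_space UNIV)"
  proof (intro nn_integral_cong)
    show "ennreal (p i (c - i)) = ennreal (p 0 (c - 2 * i))" for i
      using p_stationary[of 0 i "c - 2 * i"] by simp
  qed
  also have "\<dots> = emeasure M {\<omega> \<in> space M. even (Sg \<omega> 0 - c)}"
    by (rule emeasure_parity[symmetric])
  finally show ?thesis by (simp add: emeasure_eq_measure)
qed

definition p_odd :: real where "p_odd = prob {\<omega> \<in> space M. odd (Sg \<omega> 0)}"
definition p_even :: real where "p_even = prob {\<omega> \<in> space M. even (Sg \<omega> 0)}"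

lemma p_even_eq: "p_even = 1 - p_odd"
  unfolding p_even_def p_odd_def
  by (subst prob_neg[symmetric]) auto

text \<open>Pairing \<open>- 2 * k\<close> with its neighbour \<open>1 - 2 * k\<close> compares the
  two sums term by term, in both directions. As \<open>q\<close> tends to 1 this forces both
  probabilities to 1/2.\<close>

lemma parity_ratio: "q * p_even \<le> p_odd" "q * p_odd \<le> p_even"
proof -
  have eq: "ennreal p_even = (\<integral>\<^sup>+k. ennreal (p 0 (0 - 2 * k)) \<partial>count_space UNIV)"
    "ennreal p_odd = (\<integral>\<^sup>+k. ennreal (p 0 (1 - 2 * k)) \<partial>count_space UNIV)"
    using emeasure_parity[of 0 0] emeasure_parity[of 0 1]
    by (auto simp: p_even_def p_odd_def emeasure_eq_measure)
  have "ennreal q * ennreal p_even \<le> ennreal p_odd" "ennreal q * ennreal p_odd \<le> ennreal p_even"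
    unfolding eq using q_pos
    by (auto simp: nn_integral_cmult[symmetric] p_def ennreal_mult[symmetric]
        intro!: nn_integral_mono ennreal_leI p_neighbour[unfolded p_def])
  then show "q * p_even \<le> p_odd" "q * p_odd \<le> p_even"
    using q_pos by (auto simp: ennreal_mult[symmetric] p_even_def p_odd_def)
qed

lemma p_odd_le: "p_odd \<le> 2 * q"
proof -
  have "p_odd \<le> prob {\<omega> \<in> space M. \<not> Sg \<omega> 0 = 0}"
    unfolding p_odd_def by (intro finite_measure_mono) auto
  also have "\<dots> = 1 - p 0 0" unfolding p_def by (rule prob_neg) measurable
  finally show ?thesis using p_diag_ge by simp
qed

text \<open>The odd values 1 and -1 are the two neighbours of 0, and each has probability at least
  \<open>q * p 0 0\<close>.\<close>

lemma p_odd_ge: "2 * q * (1 - 2 * q) \<le> p_odd"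
proof -
  let ?E = "\<lambda>j. {\<omega> \<in> space M. Sg \<omega> 0 = j}"
  have "q * (1 - 2 * q) \<le> q * p 0 0" using p_diag_ge q_pos by simp
  then have "q * (1 - 2 * q) \<le> p 0 1" "q * (1 - 2 * q) \<le> p 0 (- 1)"
    using p_neighbour[of 1 0 0] p_neighbour[of "-1" 0 0] by auto
  moreover have "p 0 1 + p 0 (- 1) = prob (?E 1 \<union> ?E (- 1))"
    unfolding p_def by (subst finite_measure_Union) auto
  moreover have "\<dots> \<le> p_odd"
    unfolding p_odd_def by (intro finite_measure_mono) auto
  ultimately show ?thesis by simp
qed

end

section \<open>Identities and limits for the two expectations\<close>

theorem theorem1p6:
  fixes M :: "real \<Rightarrow> 'w measure" and Sg :: "real \<Rightarrow> 'w \<Rightarrow> int \<Rightarrow> int"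
    and ce co :: "real \<Rightarrow> ennreal"
  assumes law: "\<And>q. q > 1 \<Longrightarrow> bi_mallows (1 / q) (M q) (Sg q)"
    and ce_def: "\<And>q. ce q = (\<integral>\<^sup>+ \<omega>. C1 (rho_map \<circ> Sg q \<omega>) \<partial>M q)"
    and co_def: "\<And>q. co q = (\<integral>\<^sup>+ \<omega>. C1 (r_map \<circ> Sg q \<omega>) \<partial>M q)"
  shows "(\<forall>q>1. ce q = ennreal (measure (M q) {\<omega> \<in> space (M q). odd (Sg q \<omega> 0)})
              \<and> co q = ennreal (measure (M q) {\<omega> \<in> space (M q). even (Sg q \<omega> 0)})
              \<and> ce q + co q = 1)
    \<and> ((\<lambda>q. enn2real (ce q)) \<longlongrightarrow> 1 / 2) (at_right 1)
    \<and> ((\<lambda>q. enn2real (co q)) \<longlongrightarrow> 1 / 2) (at_right 1)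
    \<and> ((\<lambda>q. enn2real (ce q)) \<longlongrightarrow> 0) at_top
    \<and> ((\<lambda>q. enn2real (co q)) \<longlongrightarrow> 1) at_top
    \<and> (\<lambda>q. enn2real (co q) - (1 - 2 / q)) \<in> o[at_top](\<lambda>q. 1 / q)
    \<and> (\<lambda>q. enn2real (ce q) - 2 / q) \<in> o[at_top](\<lambda>q. 1 / q)"
proof -
  define f where "f q = enn2real (ce q)" for q
  define g where "g q = enn2real (co q)" for q
  have maps: "rho_map = (\<lambda>x. 1 - x)" "r_map = (\<lambda>x. 0 - x)"
    by (auto simp: rho_map_def r_map_def)
  have loc: "bi_infinite_mallows (M q) (1 / q) (Sg q)" if "q > 1" for q
    using law[OF that] that
    by (auto simp: bi_infinite_mallows_def bi_infinite_mallows_axioms_def bi_mallows_def)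
  have ce: "ce q = ennreal (measure (M q) {\<omega> \<in> space (M q). odd (Sg q \<omega> 0)})"
    and co: "co q = ennreal (measure (M q) {\<omega> \<in> space (M q). even (Sg q \<omega> 0)})"
    and sum: "ce q + co q = 1" "g q = 1 - f q"
    and f: "1 / (q + 1) \<le> f q" "f q \<le> q / (q + 1)" "2 / q - 4 / q^2 \<le> f q" "f q \<le> 2 / q"
    if q: "q > 1" for q
  proof -
    interpret bi_infinite_mallows "M q" "1 / q" "Sg q" using loc[OF q] .
    show ce: "ce q = ennreal (prob {\<omega> \<in> space (M q). odd (Sg q \<omega> 0)})"
      using nn_integral_C1_reflect[of 1] by (simp add: ce_def maps)
    show co: "co q = ennreal (prob {\<omega> \<in> space (M q). even (Sg q \<omega> 0)})"
      using nn_integral_C1_reflect[of 0] by (simp add: co_def maps)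
    have fp: "f q = p_odd" and gp: "g q = p_even"
      by (simp_all add: f_def g_def ce co p_odd_def p_even_def)
    show "g q = 1 - f q" by (simp add: fp gp p_even_eq)
    have "ce q = ennreal p_odd" "co q = ennreal p_even" "0 \<le> p_odd" "0 \<le> p_even"
      by (simp_all add: ce co p_odd_def p_even_def)
    then show "ce q + co q = 1"
      by (simp add: p_even_eq flip: ennreal_plus)
    \<comment> \<open>These bounds solve the two parity ratios, with parameter \<open>1 / q\<close>,
      for \<open>p_odd\<close>; they settle the limit at 1.\<close>
    show "1 / (q + 1) \<le> f q" "f q \<le> q / (q + 1)"
      using parity_ratio q by (simp_all add: fp p_even_eq field_simps)
    \<comment> \<open>These are \<open>2 * x * (1 - 2 * x)\<close> and \<open>2 * x\<close> at
      \<open>x = 1 / q\<close>; they govern the behaviour at infinity.\<close>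
    show "2 / q - 4 / q^2 \<le> f q" "f q \<le> 2 / q"
      using p_odd_le p_odd_ge q by (simp_all add: fp field_simps power2_eq_square)
  qed
  have gt: "eventually (\<lambda>q::real. q > 1) at_top" "eventually (\<lambda>q::real. q > 1) (at_right 1)"
    by (auto simp: eventually_gt_at_top eventually_at_right_less)
  have inv0: "((\<lambda>q::real. c / q) \<longlongrightarrow> 0) at_top" for c
    by (rule tendsto_divide_0[OF tendsto_const]) (simp add: filterlim_at_top_imp_at_infinity filterlim_ident)
  have f1: "(f \<longlongrightarrow> 1 / 2) (at_right 1)"
  proof (rule tendsto_sandwich)
    show "eventually (\<lambda>q. 1 / (q + 1) \<le> f q) (at_right 1)"
      "eventually (\<lambda>q. f q \<le> q / (q + 1)) (at_right 1)"
      using gt(2) by (eventually_elim, simp add: f)+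
  qed (auto intro!: tendsto_eq_intros)
  have f0: "(f \<longlongrightarrow> 0) at_top"
  proof (rule tendsto_sandwich)
    show "eventually (\<lambda>q. 0 \<le> f q) at_top" by (simp add: f_def)
    show "eventually (\<lambda>q. f q \<le> 2 / q) at_top"
      using gt(1) by (eventually_elim, simp add: f)
  qed (auto intro: inv0)
  have geq: "eventually (\<lambda>q. 1 - f q = g q) at_top" "eventually (\<lambda>q. 1 - f q = g q) (at_right 1)"
    by (rule eventually_mono[OF gt(1)], simp add: sum, rule eventually_mono[OF gt(2)], simp add: sum)
  have g1: "(g \<longlongrightarrow> 1 / 2) (at_right 1)"
    using Lim_transform_eventually[OF tendsto_diff[OF tendsto_const[of 1] f1] geq(2)] by simp
  have g0: "(g \<longlongrightarrow> 1) at_top"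
    using Lim_transform_eventually[OF tendsto_diff[OF tendsto_const[of 1] f0] geq(1)] by simp
  have fo: "(\<lambda>q. f q - 2 / q) \<in> o[at_top](\<lambda>q. 1 / q)"
  proof (rule smalloI_tendsto)
    show "((\<lambda>q. (f q - 2 / q) / (1 / q)) \<longlongrightarrow> 0) at_top"
    proof (rule tendsto_sandwich)
      \<comment> \<open>Multiplying the lower bound by \<open>q\<close> turns its second-order term
        \<open>4 / q^2\<close> into \<open>4 / q\<close>, which still tends to 0.\<close>
      show "eventually (\<lambda>q. - 4 / q \<le> (f q - 2 / q) / (1 / q)) at_top"
        using gt(1)
      proof eventually_elim
        case (elim q)
        have "q * (2 / q - 4 / q^2) \<le> q * f q"
          using elim f(3)[OF elim] by (intro mult_left_mono) auto
        moreover have "q * (2 / q - 4 / q^2) = 2 - 4 / q" "(f q - 2 / q) / (1 / q) = q * f q - 2"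
          using elim by (simp_all add: field_simps power2_eq_square)
        ultimately show ?case by simp
      qed
      show "eventually (\<lambda>q. (f q - 2 / q) / (1 / q) \<le> 0) at_top"
        using gt(1)
      proof eventually_elim
        case (elim q)
        then show ?case using f(4)[OF elim] by (simp add: field_simps)
      qed
    qed (use inv0[of "- 4"] in auto)
    show "eventually (\<lambda>q::real. 1 / q \<noteq> 0) at_top"
      using gt(1) by eventually_elim simp
  qed
  have go: "(\<lambda>q. g q - (1 - 2 / q)) \<in> o[at_top](\<lambda>q. 1 / q)"
  proof (rule landau_o.small.in_cong[THEN iffD2])
    \<comment> \<open>Since \<open>g = 1 - f\<close> for \<open>q > 1\<close>, the two error terms
      differ only in sign.\<close>
    show "eventually (\<lambda>q. g q - (1 - 2 / q) = - (f q - 2 / q)) at_top"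
      using gt(1) by eventually_elim (simp add: sum)
    show "(\<lambda>q. - (f q - 2 / q)) \<in> o[at_top](\<lambda>q. 1 / q)"
      using fo by (subst landau_o.small.uminus_in_iff)
  qed
  show ?thesis
    using ce co sum(1) f1 f0 g1 g0 fo go unfolding f_def g_def by blast
qed

end
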